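(* Let $p$ be an odd prime. For any integers $n\geq 1$ and $r>1$, $$(x_1x_2\cdots x_n)^{p^r}\in \gamma_2\bigl(K_n^{\mathbb Z/p^r}\bigr)^{p^{r-1}}\,\gamma_2\gamma_2\bigl(K_n^{\mathbb Z/p^r}\bigr).$$
   Context: Conventions: $[x,y]=x^{-1}y^{-1}xy$ and $[g_1,\dots,g_k]=[[g_1,\dots,g_{k-1}],g_k]$ (left-normalized commutators). The Cohen group $K_n^{\mathbb Z/p^r}=K_n^{\mathbb Z/p^r}(x_1,\dots,x_n)$ is the quotient of the free group $F(x_1,\dots,x_n)$ of rank $n$ by (the normal closure of) all left-normalized commutators $[x_{i_1},\dots,x_{i_k}]$ such that $i_s=i_t$ for some $1\le s,t\le k$, $s\ne t$, together with the powers $x_i^{p^r}$, $i=1,\dots,n$. For a group $G$, $\gamma_2(G)=[G,G]$ is the commutator subgroup and $\gamma_2\gamma_2(G)=\gamma_2(\gamma_2(G))$. For a subgroup $A$ and integer $m\ge1$, $A^{m}$ is the subgroup generated by the $m$-th powers of elements of $A$. Juxtaposition of subgroups denotes their product. *)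

theory Defs
  imports "HOL-Algebra.Algebra" "HOL-Computational_Algebra.Primes"
begin

section \<open>Free groups\<close>

text \<open>The library has no non-abelian free groups. A letter is a pair of a generator and a sign:
  \<open>(a, True)\<close> stands for \<open>a\<close> and \<open>(a, False)\<close> for its inverse. The elements of the free group
  are the reduced words; two of them are multiplied by concatenation and cancellation.\<close>

type_synonym 'a letter = "'a \<times> bool"

definition inv_letter :: "'a letter \<Rightarrow> 'a letter" where
  "inv_letter l = (fst l, \<not> snd l)"

fun reduced :: "'a letter list \<Rightarrow> bool" where
  "reduced (l # m # w) \<longleftrightarrow> m \<noteq> inv_letter l \<and> reduced (m # w)"
| "reduced _ \<longleftrightarrow> True"

fun cancel_cons :: "'a letter \<Rightarrow> 'a letter list \<Rightarrow> 'a letter list" where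
  "cancel_cons l [] = [l]"
| "cancel_cons l (m # w) = (if m = inv_letter l then w else l # m # w)"

definition free_group :: "'a set \<Rightarrow> 'a letter list monoid" where
  "free_group S = \<lparr>carrier = {w. reduced w \<and> fst ` set w \<subseteq> S},
                   monoid.mult = (\<lambda>u v. foldr cancel_cons u v), one = []\<rparr>"

definition free_gen :: "'a \<Rightarrow> 'a letter list" where
  "free_gen a = [(a, True)]"

lemma inv_letter_simps [simp]:
  "inv_letter (inv_letter l) = l" "fst (inv_letter l) = fst l"
  "inv_letter l \<noteq> l" "l \<noteq> inv_letter l"
  by (cases l; simp add: inv_letter_def)+

lemma reduced_Cons: "reduced (l # w) \<longleftrightarrow> reduced w \<and> (w = [] \<or> hd w \<noteq> inv_letter l)"
  by (cases w) auto

lemma reduced_cancel_cons: "reduced w \<Longrightarrow> reduced (cancel_cons l w)"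
  by (cases w) (auto simp: reduced_Cons)

lemma reduced_foldr_cancel_cons: "reduced v \<Longrightarrow> reduced (foldr cancel_cons u v)"
  by (induction u) (auto simp: reduced_cancel_cons)

lemma cancel_cons_inv_letter:
  "reduced w \<Longrightarrow> cancel_cons l (cancel_cons (inv_letter l) w) = w"
proof (cases w)
  case (Cons m v)
  assume "reduced w"
  with Cons show ?thesis by (cases v) auto
qed simp

lemma set_foldr_cancel_cons: "set (foldr cancel_cons u v) \<subseteq> set u \<union> set v"
proof (induction u)
  case (Cons l u)
  have "set (cancel_cons l w) \<subseteq> insert l (set w)" for w
    by (cases w) auto
  from this[of "foldr cancel_cons u v"] Cons show ?case by auto
qed simp

lemma foldr_cancel_cons_assoc:
  assumes "reduced w"
  shows "foldr cancel_cons (foldr cancel_cons u v) w =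
         foldr cancel_cons u (foldr cancel_cons v w)"
proof (induction u)
  case (Cons l u)
  have "foldr cancel_cons (cancel_cons l x) w = cancel_cons l (foldr cancel_cons x w)" for x
    using assms by (cases x) (auto simp: cancel_cons_inv_letter reduced_foldr_cancel_cons)
  with Cons show ?case by simp
qed simp

lemma foldr_cancel_cons_Nil: "reduced u \<Longrightarrow> foldr cancel_cons u [] = u"
proof (induction u)
  case (Cons l u)
  then show ?case by (cases u) auto
qed simp

lemma foldr_cancel_cons_left_inv: "foldr cancel_cons (rev (map inv_letter u)) u = []"
  by (induction u) auto

lemma carrier_free_group:
  "w \<in> carrier (free_group S) \<longleftrightarrow> reduced w \<and> fst ` set w \<subseteq> S"
  by (simp add: free_group_def)

lemma mult_free_group: "u \<otimes>\<^bsub>free_group S\<^esub> v = foldr cancel_cons u v"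
  by (simp add: free_group_def)

lemma one_free_group: "\<one>\<^bsub>free_group S\<^esub> = []"
  by (simp add: free_group_def)

lemmas free_group_simps = carrier_free_group mult_free_group one_free_group

lemma foldr_cancel_cons_in_carrier:
  assumes "fst ` set u \<subseteq> S" "v \<in> carrier (free_group S)"
  shows "foldr cancel_cons u v \<in> carrier (free_group S)"
proof -
  have "fst ` set (foldr cancel_cons u v) \<subseteq> fst ` (set u \<union> set v)"
    by (intro image_mono set_foldr_cancel_cons)
  also have "\<dots> \<subseteq> S" using assms by (auto simp: carrier_free_group)
  finally show ?thesis
    using assms by (simp add: carrier_free_group reduced_foldr_cancel_cons)
qed

lemma group_free_group: "group (free_group S)"
proof (rule groupI)
  fix u assume u: "u \<in> carrier (free_group S)"
  let ?v = "foldr cancel_cons (rev (map inv_letter u)) []"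
  have "?v \<in> carrier (free_group S)"
    using u by (intro foldr_cancel_cons_in_carrier) (auto simp: carrier_free_group)
  moreover have "?v \<otimes>\<^bsub>free_group S\<^esub> u = \<one>\<^bsub>free_group S\<^esub>"
    using u by (simp add: free_group_simps foldr_cancel_cons_assoc foldr_cancel_cons_left_inv)
  ultimately show "\<exists>v\<in>carrier (free_group S). v \<otimes>\<^bsub>free_group S\<^esub> u = \<one>\<^bsub>free_group S\<^esub>"
    by blast
next
  fix u v assume "u \<in> carrier (free_group S)" "v \<in> carrier (free_group S)"
  then show "u \<otimes>\<^bsub>free_group S\<^esub> v \<in> carrier (free_group S)"
    by (simp add: mult_free_group foldr_cancel_cons_in_carrier carrier_free_group[of u])
qed (simp_all add: free_group_simps foldr_cancel_cons_assoc)

lemma free_gen_in_carrier: "a \<in> S \<Longrightarrow> free_gen a \<in> carrier (free_group S)"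
  by (simp add: free_gen_def carrier_free_group)

lemma inv_free_gen:
  assumes "a \<in> S" shows "inv\<^bsub>free_group S\<^esub> (free_gen a) = [(a, False)]"
proof -
  interpret group "free_group S" by (rule group_free_group)
  show ?thesis
    using assms by (intro inv_equality) (auto simp: free_group_simps free_gen_def inv_letter_def)
qed

lemma generate_free_gen: "generate (free_group S) (free_gen ` S) = carrier (free_group S)"
proof
  interpret group "free_group S" by (rule group_free_group)
  show "generate (free_group S) (free_gen ` S) \<subseteq> carrier (free_group S)"
    by (intro generate_incl) (auto simp: free_gen_in_carrier)
  show "carrier (free_group S) \<subseteq> generate (free_group S) (free_gen ` S)"
  proof
    fix w assume "w \<in> carrier (free_group S)"
    then show "w \<in> generate (free_group S) (free_gen ` S)"
    proof (induction w)
      case Nil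
      then show ?case using generate.one[of "free_group S"] by (simp add: one_free_group)
    next
      case (Cons l w)
      from Cons.prems have w: "w \<in> carrier (free_group S)" and l: "fst l \<in> S"
        by (auto simp: carrier_free_group reduced_Cons)
      have "[l] \<in> generate (free_group S) (free_gen ` S)"
      proof (cases "snd l")
        case True
        then have "[l] = free_gen (fst l)" by (cases l) (simp add: free_gen_def)
        then show ?thesis using l by (simp add: generate.incl)
      next
        case False
        then have "[l] = inv\<^bsub>free_group S\<^esub> (free_gen (fst l))"
          using l by (cases l) (simp add: inv_free_gen)
        then show ?thesis using l by (simp add: generate.inv)
      qed
      moreover have "l # w = [l] \<otimes>\<^bsub>free_group S\<^esub> w"
        using Cons.prems by (cases w) (auto simp: free_group_simps)
      ultimately show ?case using generate.eng Cons.IH[OF w] by fastforce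
    qed
  qed
qed

text \<open>Existence in the universal property; uniqueness follows from \<open>generate_free_gen\<close>.\<close>

lemma free_group_lift:
  assumes "group G" "f \<in> S \<rightarrow> carrier G"
  shows "\<exists>h \<in> hom (free_group S) G. \<forall>a\<in>S. h (free_gen a) = f a"
proof -
  interpret group G by fact
  define e where "e l = (if snd l then f (fst l) else inv\<^bsub>G\<^esub> (f (fst l)))" for l
  define h where "h w = foldr (\<lambda>l y. e l \<otimes>\<^bsub>G\<^esub> y) w \<one>\<^bsub>G\<^esub>" for w
  have e: "e l \<in> carrier G" if "fst l \<in> S" for l
    using that assms(2) by (auto simp: e_def)
  have e_inv: "e (inv_letter l) = inv\<^bsub>G\<^esub> (e l)" if "fst l \<in> S" for l
  proof -
    have "f (fst l) \<in> carrier G" using that assms(2) by blast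
    then show ?thesis by (simp add: e_def inv_letter_def)
  qed
  have h: "h w \<in> carrier G" if "fst ` set w \<subseteq> S" for w
    using that by (induction w) (auto simp: h_def e)
  have h_cons: "h (cancel_cons l w) = e l \<otimes>\<^bsub>G\<^esub> h w"
    if "fst l \<in> S" "fst ` set w \<subseteq> S" for l w
  proof (cases w)
    case (Cons m v)
    with that have "h v \<in> carrier G" by (intro h) auto
    with that e[of l] show ?thesis
      unfolding Cons by (auto simp: h_def e_inv m_assoc[symmetric])
  qed (simp add: h_def)
  have "h (u \<otimes>\<^bsub>free_group S\<^esub> v) = h u \<otimes>\<^bsub>G\<^esub> h v"
    if "fst ` set u \<subseteq> S" "v \<in> carrier (free_group S)" for u v
    using that(1)
  proof (induction u)
    case Nil
    with that(2) show ?case by (simp add: h_def[of "[]"] free_group_simps h)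
  next
    case (Cons l u)
    have "foldr cancel_cons u v \<in> carrier (free_group S)"
      using Cons.prems that(2) by (intro foldr_cancel_cons_in_carrier) auto
    then have "h ((l # u) \<otimes>\<^bsub>free_group S\<^esub> v) = e l \<otimes>\<^bsub>G\<^esub> (h u \<otimes>\<^bsub>G\<^esub> h v)"
      using Cons by (simp add: free_group_simps h_cons)
    also have "\<dots> = h (l # u) \<otimes>\<^bsub>G\<^esub> h v"
      using Cons.prems that(2) h[of u] h[of v] e[of l]
      by (simp add: h_def[of "l # u"] h_def[of u, symmetric] m_assoc free_group_simps)
    finally show ?case .
  qed
  then have "h \<in> hom (free_group S) G"
    by (intro homI) (auto simp: carrier_free_group h)
  moreover have "h (free_gen a) = f a" if "a \<in> S" for a
  proof -
    have "f a \<in> carrier G" using that assms(2) by blast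
    then show ?thesis by (simp add: h_def e_def free_gen_def)
  qed
  ultimately show ?thesis by blast
qed


section \<open>Commutators, normal closures, powers of subgroups\<close>

definition commutator :: "('a, 'b) monoid_scheme \<Rightarrow> 'a \<Rightarrow> 'a \<Rightarrow> 'a" where
  "commutator G x y = inv\<^bsub>G\<^esub> x \<otimes>\<^bsub>G\<^esub> inv\<^bsub>G\<^esub> y \<otimes>\<^bsub>G\<^esub> x \<otimes>\<^bsub>G\<^esub> y"

text \<open>The commutator \<open>[[\<dots>[[g\<^sub>1, g\<^sub>2], g\<^sub>3], \<dots>], g\<^sub>k]\<close> of a non-empty list; the value for the
  empty list is a dummy.\<close>

primrec left_normed_commutator :: "('a, 'b) monoid_scheme \<Rightarrow> 'a list \<Rightarrow> 'a" where
  "left_normed_commutator G [] = \<one>\<^bsub>G\<^esub>"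
| "left_normed_commutator G (g # gs) = foldl (commutator G) g gs"

lemma left_normed_commutator_closed:
  assumes "group G" "set gs \<subseteq> carrier G"
  shows "left_normed_commutator G gs \<in> carrier G"
proof -
  interpret group G by fact
  have "foldl (commutator G) g hs \<in> carrier G"
    if "g \<in> carrier G" "set hs \<subseteq> carrier G" for g hs
    using that by (induction hs arbitrary: g) (auto simp: commutator_def)
  then show ?thesis using assms(2) by (cases gs) auto
qed

definition normal_closure :: "('a, 'b) monoid_scheme \<Rightarrow> 'a set \<Rightarrow> 'a set" where
  "normal_closure G R =
     generate G {g \<otimes>\<^bsub>G\<^esub> x \<otimes>\<^bsub>G\<^esub> inv\<^bsub>G\<^esub> g | g x. g \<in> carrier G \<and> x \<in> R}"

definition power_subgroup :: "('a, 'b) monoid_scheme \<Rightarrow> 'a set \<Rightarrow> nat \<Rightarrow> 'a set" where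
  "power_subgroup G A m = generate G {a [^]\<^bsub>G\<^esub> m | a. a \<in> A}"

text \<open>The library's \<open>derived\<close> is generated by the commutators \<open>x y x\<inverse> y\<inverse>\<close>; on a
  subgroup these are the same elements as the \<open>x\<inverse> y\<inverse> x y\<close>.\<close>

abbreviation gamma2 :: "('a, 'b) monoid_scheme \<Rightarrow> 'a set" where
  "gamma2 G \<equiv> derived G (carrier G)"

lemma derived_eq_generate_commutator:
  assumes "group G" "subgroup H G"
  shows "derived G H = generate G {commutator G x y | x y. x \<in> H \<and> y \<in> H}"
proof -
  interpret group G by fact
  interpret subgroup H G by fact
  have "commutator G x y \<in> derived_set G H" if "x \<in> H" "y \<in> H" for x y
  proof -
    have "commutator G x y = inv\<^bsub>G\<^esub> x \<otimes>\<^bsub>G\<^esub> inv\<^bsub>G\<^esub> y \<otimes>\<^bsub>G\<^esub> inv\<^bsub>G\<^esub> (inv\<^bsub>G\<^esub> x) \<otimes>\<^bsub>G\<^esub> inv\<^bsub>G\<^esub> (inv\<^bsub>G\<^esub> y)"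
      using that by (simp add: commutator_def)
    then show ?thesis using that by blast
  qed
  moreover have "x \<otimes>\<^bsub>G\<^esub> y \<otimes>\<^bsub>G\<^esub> inv\<^bsub>G\<^esub> x \<otimes>\<^bsub>G\<^esub> inv\<^bsub>G\<^esub> y = commutator G (inv\<^bsub>G\<^esub> x) (inv\<^bsub>G\<^esub> y)"
    if "x \<in> H" "y \<in> H" for x y
    using that by (simp add: commutator_def)
  then have "c \<in> {commutator G x y | x y. x \<in> H \<and> y \<in> H}" if "c \<in> derived_set G H" for c
    using that m_inv_closed by blast
  ultimately have "derived_set G H = {commutator G x y | x y. x \<in> H \<and> y \<in> H}"
    by blast
  then show ?thesis by (simp add: derived_def)
qed

lemma normal_normal_closure:
  assumes "group G" "R \<subseteq> carrier G"
  shows "normal_closure G R \<lhd> G"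
proof -
  interpret group G by fact
  let ?C = "{g \<otimes>\<^bsub>G\<^esub> x \<otimes>\<^bsub>G\<^esub> inv\<^bsub>G\<^esub> g | g x. g \<in> carrier G \<and> x \<in> R}"
  have C: "?C \<subseteq> carrier G" using assms(2) by auto
  show ?thesis unfolding normal_closure_def
  proof (rule normal_generateI[OF C])
    fix c g assume "c \<in> ?C" "g \<in> carrier G"
    then obtain k x where kx: "c = k \<otimes>\<^bsub>G\<^esub> x \<otimes>\<^bsub>G\<^esub> inv\<^bsub>G\<^esub> k" "k \<in> carrier G" "x \<in> R" by blast
    with \<open>g \<in> carrier G\<close> assms(2)
    have "g \<otimes>\<^bsub>G\<^esub> c \<otimes>\<^bsub>G\<^esub> inv\<^bsub>G\<^esub> g = (g \<otimes>\<^bsub>G\<^esub> k) \<otimes>\<^bsub>G\<^esub> x \<otimes>\<^bsub>G\<^esub> inv\<^bsub>G\<^esub> (g \<otimes>\<^bsub>G\<^esub> k)"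
      by (auto simp: inv_mult_group m_assoc subset_iff)
    with kx \<open>g \<in> carrier G\<close> show "g \<otimes>\<^bsub>G\<^esub> c \<otimes>\<^bsub>G\<^esub> inv\<^bsub>G\<^esub> g \<in> ?C" by blast
  qed
qed

lemma normal_closure_minimal:
  assumes "N \<lhd> G" "R \<subseteq> N"
  shows "normal_closure G R \<subseteq> N"
proof -
  interpret normal N G by fact
  show ?thesis unfolding normal_closure_def
    using assms(2) inv_op_closed2 by (intro generate_subgroup_incl) (auto intro: subgroup_axioms)
qed


section \<open>The Cohen group\<close>

definition cohen_relators :: "nat \<Rightarrow> nat \<Rightarrow> nat letter list set" where
  "cohen_relators n q =
     {left_normed_commutator (free_group {1..n}) (map free_gen is) | is.
        set is \<subseteq> {1..n} \<and> \<not> distinct is}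
     \<union> {free_gen i [^]\<^bsub>free_group {1..n}\<^esub> q | i. i \<in> {1..n}}"

lemma cohen_relators_in_carrier: "cohen_relators n q \<subseteq> carrier (free_group {1..n})"
proof -
  interpret group "free_group {1..n}" by (rule group_free_group)
  have "left_normed_commutator (free_group {1..n}) (map free_gen is) \<in> carrier (free_group {1..n})"
    if "set is \<subseteq> {1..n}" for "is"
    using that by (intro left_normed_commutator_closed group_free_group)
      (auto intro!: free_gen_in_carrier)
  moreover have "free_gen i [^]\<^bsub>free_group {1..n}\<^esub> q \<in> carrier (free_group {1..n})"
    if "i \<in> {1..n}" for i
    using that by (intro nat_pow_closed free_gen_in_carrier)
  ultimately show ?thesis
    unfolding cohen_relators_def by blast
qed

text \<open>\<open>cohen_group n q\<close> is \<open>K\<^sub>n\<close> with coefficients \<open>\<int>/q\<close>, and \<open>cohen_gen n q i\<close> the image of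
  \<open>x\<^sub>i\<close> in it.\<close>

definition cohen_group :: "nat \<Rightarrow> nat \<Rightarrow> nat letter list set monoid" where
  "cohen_group n q =
     free_group {1..n} Mod normal_closure (free_group {1..n}) (cohen_relators n q)"

lemma group_cohen_group: "group (cohen_group n q)"
  unfolding cohen_group_def
  by (rule normal.factorgroup_is_group[OF normal_normal_closure[OF group_free_group
      cohen_relators_in_carrier]])

definition cohen_gen :: "nat \<Rightarrow> nat \<Rightarrow> nat \<Rightarrow> nat letter list set" where
  "cohen_gen n q i =
     normal_closure (free_group {1..n}) (cohen_relators n q) #>\<^bsub>free_group {1..n}\<^esub> free_gen i"

definition cohen_gen_prod :: "nat \<Rightarrow> nat \<Rightarrow> nat letter list set" where
  "cohen_gen_prod n q =
     foldr (\<lambda>x y. x \<otimes>\<^bsub>cohen_group n q\<^esub> y) (map (cohen_gen n q) [1..<Suc n]) \<one>\<^bsub>cohen_group n q\<^esub>"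

end

theory Submission
  imports Defs "HOL-Number_Theory.Cong"
begin

text \<open>Let \<open>q = p\<^sup>r\<close> and \<open>m = p\<^sup>r\<^sup>-\<^sup>1\<close>. Passing to the quotient of \<open>K\<close> by the subgroup on the right-hand side, the
claim becomes \<open>(x\<^sub>1 \<cdots> x\<^sub>n)\<^sup>q = 1\<close> in a metabelian group whose commutator subgroup \<open>A\<close> has exponent dividing
\<open>m\<close>. Since \<open>x\<^sub>i\<^sup>q = 1\<close>, it suffices that \<open>(g h)\<^sup>q = g\<^sup>q h\<^sup>q\<close> whenever \<open>g\<close> and \<open>h\<close> are products of
generators.

Write \<open>A\<close> additively, as a module over the group, which acts by conjugation and through its abelianization.
In every metabelian group \<open>(g h)\<^sup>q = g\<^sup>q h\<^sup>q \<cdot> \<Sum>\<^bsub>j < i < q\<^esub> h\<^sup>i g\<^sup>j [h, g]\<close> (\<open>power_mult_metabelian\<close>). The relations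
\<open>[x\<^sub>i, x\<^sub>j, x\<^sub>k, x\<^sub>k] = 1\<close> say that \<open>X\<^sub>k\<^sup>2\<close> kills \<open>A\<close>, where \<open>X\<^sub>k = x\<^sub>k - 1\<close> (\<open>commutator_square_eq_one\<close>),
so that \<open>x\<^sub>k\<^sup>i\<close> acts on \<open>A\<close> as \<open>1 + i X\<^sub>k\<close>. A product of generators then acts through a product of such
factors, and \<open>h\<^sup>i g\<^sup>j [h, g]\<close> is a polynomial in \<open>i\<close> and \<open>j\<close> with coefficients in \<open>A\<close>
(\<open>poly_actor_of_square\<close>, \<open>poly_actor_mult\<close>).

The correction term is therefore a combination of elements of \<open>A\<close> whose integer coefficients are the double
power sums \<open>\<Sum>\<^bsub>j < i < q\<^esub> i\<^sup>a j\<^sup>b\<close>. For odd \<open>p\<close> all of these are divisible by \<open>m\<close> (\<open>double_power_sum_dvd\<close>), and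
\<open>m\<close> kills \<open>A\<close>.\<close>

section \<open>Power sums modulo prime powers\<close>

lemma sum_lessThan_add:
  fixes f :: "nat \<Rightarrow> 'a :: comm_monoid_add"
  shows "(\<Sum>i<k + m. f i) = (\<Sum>i<k. f i) + (\<Sum>i<m. f (k + i))"
  by (induction m) (simp_all add: add.assoc)

lemma sum_blocks:
  fixes f :: "nat \<Rightarrow> 'a :: comm_monoid_add"
  shows "(\<Sum>i<k * m. f i) = (\<Sum>u<k. \<Sum>i<m. f (u * m + i))"
proof (induction k)
  case (Suc k)
  have "Suc k * m = k * m + m" by simp
  then show ?case by (simp only: sum_lessThan_add Suc sum.lessThan_Suc)
qed simp

lemma cong_add_block: "[(u * m + i) ^ k = i ^ k] (mod m)" for u m i k :: nat
  by (intro cong_pow) (simp add: cong_def)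

text \<open>Cut the range below \<open>p ^ Suc s\<close> into \<open>p\<close> blocks of length \<open>p ^ s\<close>: modulo \<open>p ^ s\<close> all blocks have
the same sum, so passing from \<open>s\<close> to \<open>Suc s\<close> multiplies the sum by \<open>p\<close>. For a prime \<open>p\<close> the exponent
\<open>s - 1\<close> cannot be improved to \<open>s\<close>: for \<open>k = p - 1\<close> and \<open>s = 1\<close> the sum is \<open>-1\<close> modulo \<open>p\<close>.\<close>

lemma power_sum_dvd: "p ^ (s - 1) dvd (\<Sum>i<p ^ s. i ^ k)" for p s k :: nat
proof (induction s)
  case (Suc s)
  have "[(\<Sum>i<p ^ Suc s. i ^ k) = (\<Sum>u<p. \<Sum>i<p ^ s. i ^ k)] (mod p ^ s)"
    unfolding power_Suc sum_blocks by (intro cong_sum cong_add_block)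
  also have "(\<Sum>u<p. \<Sum>i<p ^ s. i ^ k) = p * (\<Sum>i<p ^ s. i ^ k)"
    by simp
  finally have *: "[(\<Sum>i<p ^ Suc s. i ^ k) = p * (\<Sum>i<p ^ s. i ^ k)] (mod p ^ s)" .
  have "p ^ s dvd p * (\<Sum>i<p ^ s. i ^ k)"
  proof (cases s)
    case (Suc t)
    then show ?thesis using mult_dvd_mono[OF dvd_refl Suc.IH, of p] by simp
  qed simp
  with * show ?case by (simp add: cong_dvd_iff)
qed simp

text \<open>The same block decomposition, now of the triangle \<open>j < i < p ^ Suc s\<close>: modulo \<open>p ^ s\<close> it consists of
\<open>p\<close> copies of the smaller triangle and of \<open>p (p - 1) / 2\<close> full squares. The sum over a square is a product of
two power sums. For \<open>p = 2\<close> the statement fails: \<open>s = 2\<close> and \<open>a = b = 1\<close> give \<open>11\<close>.\<close>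

lemma double_power_sum_dvd:
  fixes p s a b :: nat
  assumes "odd p"
  shows "p ^ (s - 1) dvd (\<Sum>i<p ^ s. \<Sum>j<i. i ^ a * j ^ b)"
proof (induction s)
  case (Suc s)
  define m where "m = p ^ s"
  define A where "A = (\<Sum>i<m. i ^ a)"
  define B where "B = (\<Sum>j<m. j ^ b)"
  define T where "T = (\<Sum>i<m. \<Sum>j<i. i ^ a * j ^ b)"
  have inner: "[(\<Sum>j<u * m + i. j ^ b) = u * B + (\<Sum>j<i. j ^ b)] (mod m)" for u i
  proof -
    have "(\<Sum>j<u * m + i. j ^ b) = (\<Sum>j<u * m. j ^ b) + (\<Sum>j<i. (u * m + j) ^ b)"
      by (rule sum_lessThan_add)
    also have "(\<Sum>j<u * m. j ^ b) = (\<Sum>v<u. \<Sum>j<m. (v * m + j) ^ b)"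
      by (rule sum_blocks)
    also have "[\<dots> + (\<Sum>j<i. (u * m + j) ^ b) = (\<Sum>v<u. \<Sum>j<m. j ^ b) + (\<Sum>j<i. j ^ b)] (mod m)"
      by (intro cong_add cong_sum cong_add_block)
    finally show ?thesis by (simp add: B_def)
  qed
  have sum_i: "(\<Sum>i<m. i ^ a * (u * B + (\<Sum>j<i. j ^ b))) = u * (A * B) + T" for u
    by (simp add: A_def T_def sum.distrib sum_distrib_left sum_distrib_right algebra_simps)
  have "(\<Sum>i<p ^ Suc s. \<Sum>j<i. i ^ a * j ^ b) =
        (\<Sum>u<p. \<Sum>i<m. (u * m + i) ^ a * (\<Sum>j<u * m + i. j ^ b))"
    by (simp only: power_Suc sum_blocks sum_distrib_left m_def)
  moreover have "[(\<Sum>u<p. \<Sum>i<m. (u * m + i) ^ a * (\<Sum>j<u * m + i. j ^ b)) =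
        (\<Sum>u<p. \<Sum>i<m. i ^ a * (u * B + (\<Sum>j<i. j ^ b)))] (mod m)"
    by (intro cong_sum cong_mult cong_add_block inner)
  moreover have "(\<Sum>u<p. \<Sum>i<m. i ^ a * (u * B + (\<Sum>j<i. j ^ b))) = (\<Sum>u<p. u) * (A * B) + p * T"
    by (simp add: sum_i sum.distrib sum_distrib_right)
  ultimately have *: "[(\<Sum>i<p ^ Suc s. \<Sum>j<i. i ^ a * j ^ b) = (\<Sum>u<p. u) * (A * B) + p * T] (mod m)"
    by simp
  have "m dvd (\<Sum>u<p. u) * (A * B) + p * T"
  proof (cases s)
    case (Suc t)
    have A: "p ^ t dvd A" and B: "p ^ t dvd B" and T: "p ^ t dvd T"
      using power_sum_dvd[of p s a] power_sum_dvd[of p s b] Suc.IH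
      by (auto simp: Suc A_def B_def T_def m_def)
    \<comment> \<open>Here \<open>p\<close> has to be odd: \<open>0 + \<dots> + (p - 1) = p (p - 1) / 2\<close>.\<close>
    have "(\<Sum>u<p. u) = p * ((p - 1) div 2)"
    proof -
      from assms obtain c where c: "p = 2 * c + 1" by (elim oddE)
      have "(\<Sum>u<2 * c + 1. u) = (2 * c + 1) * c" by (induction c) auto
      then show ?thesis by (simp add: c)
    qed
    then have "p dvd (\<Sum>u<p. u)" by simp
    then show ?thesis
      using A B T by (simp add: m_def Suc mult_dvd_mono dvd_mult2)
  qed (simp add: m_def)
  with * show ?case by (simp add: cong_dvd_iff m_def)
qed simp

section \<open>Conjugation and commutators\<close>

text \<open>The right action \<open>a\<^sup>g\<close>, which goes with the convention \<open>[x, y] = x\<inverse> y\<inverse> x y\<close>.\<close>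

definition conjugate :: "('a, 'b) monoid_scheme \<Rightarrow> 'a \<Rightarrow> 'a \<Rightarrow> 'a" where
  "conjugate G a g = inv\<^bsub>G\<^esub> g \<otimes>\<^bsub>G\<^esub> a \<otimes>\<^bsub>G\<^esub> g"

text \<open>The product \<open>f (n - 1) \<cdots> f 1 f 0\<close>. Descending indices are the order in which the factors appear when
\<open>(g h)\<^sup>n\<close> is collected; the order matters, since the group is not commutative.\<close>

primrec prod_below :: "('a, 'b) monoid_scheme \<Rightarrow> (nat \<Rightarrow> 'a) \<Rightarrow> nat \<Rightarrow> 'a" where
  "prod_below G f 0 = \<one>\<^bsub>G\<^esub>"
| "prod_below G f (Suc n) = f n \<otimes>\<^bsub>G\<^esub> prod_below G f n"

context group
begin

lemma mult_inv_cancel [simp]: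
  assumes "x \<in> carrier G" "y \<in> carrier G"
  shows "x \<otimes> (inv x \<otimes> y) = y" "inv x \<otimes> (x \<otimes> y) = y"
  using assms by (simp_all add: m_assoc[symmetric])

lemma conjugate_closed [simp]:
  "a \<in> carrier G \<Longrightarrow> g \<in> carrier G \<Longrightarrow> conjugate G a g \<in> carrier G"
  by (simp add: conjugate_def)

lemma commutator_closed [simp]:
  "a \<in> carrier G \<Longrightarrow> g \<in> carrier G \<Longrightarrow> commutator G a g \<in> carrier G"
  by (simp add: commutator_def)

lemma prod_below_closed [simp]:
  "(\<And>i. f i \<in> carrier G) \<Longrightarrow> prod_below G f n \<in> carrier G"
  by (induction n) auto

lemma conjugate_one [simp]: "a \<in> carrier G \<Longrightarrow> conjugate G a \<one> = a"
  by (simp add: conjugate_def)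

lemma one_conjugate [simp]: "g \<in> carrier G \<Longrightarrow> conjugate G \<one> g = \<one>"
  by (simp add: conjugate_def)

lemma conjugate_mult:
  assumes "a \<in> carrier G" "b \<in> carrier G" "g \<in> carrier G"
  shows "conjugate G (a \<otimes> b) g = conjugate G a g \<otimes> conjugate G b g"
  using assms by (simp add: conjugate_def m_assoc)

lemma conjugate_inv:
  assumes "a \<in> carrier G" "g \<in> carrier G"
  shows "conjugate G (inv a) g = inv (conjugate G a g)"
  using assms by (simp add: conjugate_def m_assoc inv_mult_group)

lemma conjugate_by_mult:
  assumes "a \<in> carrier G" "g \<in> carrier G" "h \<in> carrier G"
  shows "conjugate G a (g \<otimes> h) = conjugate G (conjugate G a g) h"
  using assms by (simp add: conjugate_def m_assoc inv_mult_group)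

lemma conjugate_pow:
  assumes "a \<in> carrier G" "g \<in> carrier G"
  shows "conjugate G (a [^] (n::nat)) g = conjugate G a g [^] n"
  using assms by (induction n) (simp_all add: conjugate_mult)

lemma conjugate_prod_below:
  assumes "\<And>i. f i \<in> carrier G" "g \<in> carrier G"
  shows "conjugate G (prod_below G f n) g = prod_below G (\<lambda>i. conjugate G (f i) g) n"
  using assms by (induction n) (simp_all add: conjugate_mult)

lemma conjugate_eq_mult_commutator:
  assumes "a \<in> carrier G" "g \<in> carrier G"
  shows "conjugate G a g = a \<otimes> commutator G a g"
  using assms by (simp add: conjugate_def commutator_def m_assoc)

lemma commutator_eq_inv_mult_conjugate:
  assumes "a \<in> carrier G" "g \<in> carrier G"
  shows "commutator G a g = inv a \<otimes> conjugate G a g"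
  using assms by (simp add: conjugate_def commutator_def m_assoc)

lemma commutator_mult_right:
  assumes "a \<in> carrier G" "g \<in> carrier G" "h \<in> carrier G"
  shows "commutator G a (g \<otimes> h) = commutator G a h \<otimes> conjugate G (commutator G a g) h"
  using assms by (simp add: conjugate_def commutator_def m_assoc inv_mult_group)

lemma commutator_mult_left:
  assumes "a \<in> carrier G" "b \<in> carrier G" "g \<in> carrier G"
  shows "commutator G (a \<otimes> b) g = conjugate G (commutator G a g) b \<otimes> commutator G b g"
  using assms by (simp add: conjugate_def commutator_def m_assoc inv_mult_group)

lemma commutator_inv_left:
  assumes "a \<in> carrier G" "g \<in> carrier G"
  shows "commutator G (inv a) g = inv (conjugate G (commutator G a g) (inv a))"
  using assms by (simp add: conjugate_def commutator_def m_assoc inv_mult_group)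

lemma inv_commutator:
  assumes "a \<in> carrier G" "g \<in> carrier G"
  shows "inv (commutator G a g) = commutator G g a"
  using assms by (simp add: commutator_def m_assoc inv_mult_group)

text \<open>Collect in \<open>(g h)\<^sup>n\<^sup>+\<^sup>1 = g h (g\<^sup>n h\<^sup>n \<cdots>)\<close>: moving the single \<open>h\<close> to the right of \<open>g\<^sup>n\<close> creates
\<open>[h, g\<^sup>n]\<close>, and moving that commutator to the right of \<open>h\<^sup>n\<close> conjugates it.\<close>

lemma power_mult_collect:
  assumes g: "g \<in> carrier G" and h: "h \<in> carrier G"
  shows "(g \<otimes> h) [^] n =
    g [^] n \<otimes> h [^] n \<otimes> prod_below G (\<lambda>i. conjugate G (commutator G h (g [^] i)) (h [^] i)) n"
    (is "_ = _ \<otimes> _ \<otimes> ?P n")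
proof (induction n)
  case (Suc n)
  have P: "?P n \<in> carrier G" using assms by simp
  have "(g \<otimes> h) [^] Suc n = g \<otimes> h \<otimes> (g \<otimes> h) [^] n"
    using assms by (intro nat_pow_Suc2) simp
  also have "\<dots> = g \<otimes> (h \<otimes> g [^] n) \<otimes> (h [^] n \<otimes> ?P n)"
    using assms P by (simp only: Suc m_assoc m_closed nat_pow_closed)
  also have "h \<otimes> g [^] n = g [^] n \<otimes> h \<otimes> commutator G h (g [^] n)"
    using assms by (simp add: commutator_def m_assoc)
  also have "g \<otimes> (g [^] n \<otimes> h \<otimes> commutator G h (g [^] n)) \<otimes> (h [^] n \<otimes> ?P n) =
    (g \<otimes> g [^] n) \<otimes> (h \<otimes> h [^] n) \<otimes> (conjugate G (commutator G h (g [^] n)) (h [^] n) \<otimes> ?P n)"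
    using assms P by (simp add: conjugate_def m_assoc)
  also have "\<dots> = g [^] Suc n \<otimes> h [^] Suc n \<otimes> ?P (Suc n)"
    using assms by (simp only: nat_pow_Suc2 prod_below.simps)
  finally show ?case .
qed simp

lemma conjugate_in_normal:
  assumes "N \<lhd> G" "a \<in> N" "g \<in> carrier G" shows "conjugate G a g \<in> N"
  using normal.inv_op_closed1[OF assms(1) assms(3) assms(2)] by (simp add: conjugate_def)

lemma commutator_generate_in_normal:
  assumes N: "N \<lhd> G" and S: "S \<subseteq> carrier G" and k: "k \<in> carrier G"
    and "\<And>x. x \<in> S \<Longrightarrow> commutator G x k \<in> N" and "g \<in> generate G S"
  shows "commutator G g k \<in> N"
  using \<open>g \<in> generate G S\<close>
proof (induction g rule: generate.induct)
  case one
  show ?case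
    using k subgroup.one_closed[OF normal_imp_subgroup[OF N]] by (simp add: commutator_def)
next
  case (inv x)
  then have x: "x \<in> carrier G" and "commutator G x k \<in> N" using assms by auto
  then have "inv (conjugate G (commutator G x k) (inv x)) \<in> N"
    by (intro subgroup.m_inv_closed[OF normal_imp_subgroup[OF N]] conjugate_in_normal[OF N]) auto
  then show ?case using x k by (simp add: commutator_inv_left)
next
  case (eng x y)
  then have x: "x \<in> carrier G" and y: "y \<in> carrier G"
    using generate_in_carrier[OF S] by auto
  have "conjugate G (commutator G x k) y \<otimes> commutator G y k \<in> N"
    using eng.IH y by (intro subgroup.m_closed[OF normal_imp_subgroup[OF N]] conjugate_in_normal[OF N])
  then show ?case using x y k by (simp add: commutator_mult_left)
qed (use assms in auto)

text \<open>Modulo \<open>N\<close> the generators commute pairwise, so the quotient by \<open>N\<close> is abelian. The commutator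
identities for products and inverses carry this from the generators to all elements, one argument at a time.\<close>

lemma derived_subset_normal:
  assumes N: "N \<lhd> G" and S: "S \<subseteq> carrier G" and gen: "generate G S = carrier G"
    and comm: "\<And>x y. x \<in> S \<Longrightarrow> y \<in> S \<Longrightarrow> commutator G x y \<in> N"
  shows "gamma2 G \<subseteq> N"
proof -
  have *: "commutator G g y \<in> N" if "g \<in> carrier G" "y \<in> S" for g y
    by (rule commutator_generate_in_normal[OF N S]) (use that S comm gen in auto)
  have **: "commutator G y g \<in> N" if "g \<in> carrier G" "y \<in> S" for g y
    using *[OF that] that S subgroup.m_inv_closed[OF normal_imp_subgroup[OF N]]
    by (metis inv_commutator subsetD)
  have "commutator G g h \<in> N" if "g \<in> carrier G" "h \<in> carrier G" for g h
    by (rule commutator_generate_in_normal[OF N S]) (use that ** gen in auto)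
  then show ?thesis
    unfolding derived_eq_generate_commutator[OF group_axioms subgroup_self]
    by (intro generate_subgroup_incl normal_imp_subgroup[OF N]) auto
qed

end

section \<open>Metabelian groups\<close>

locale metabelian_group = group +
  assumes gamma2_commute: "a \<in> gamma2 G \<Longrightarrow> b \<in> gamma2 G \<Longrightarrow> a \<otimes> b = b \<otimes> a"

sublocale metabelian_group \<subseteq> A: normal "gamma2 G" G
  by (rule derived_self_is_normal)

context metabelian_group
begin

lemma commutator_in_gamma2:
  "g \<in> carrier G \<Longrightarrow> h \<in> carrier G \<Longrightarrow> commutator G g h \<in> gamma2 G"
  unfolding derived_eq_generate_commutator[OF group_axioms subgroup_self]
  by (intro generate.incl) blast

lemma conjugate_in_gamma2 [simp]:
  "a \<in> gamma2 G \<Longrightarrow> g \<in> carrier G \<Longrightarrow> conjugate G a g \<in> gamma2 G"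
  by (rule conjugate_in_normal[OF A.normal_axioms])

lemma pow_in_gamma2 [simp]: "a \<in> gamma2 G \<Longrightarrow> a [^] (n::nat) \<in> gamma2 G"
  by (induction n) simp_all

lemma prod_below_in_gamma2 [simp]:
  "(\<And>i. f i \<in> gamma2 G) \<Longrightarrow> prod_below G f n \<in> gamma2 G"
  by (induction n) auto

lemma mult_ac_gamma2:
  assumes "a \<in> gamma2 G" "b \<in> gamma2 G" "c \<in> gamma2 G"
  shows "a \<otimes> b \<otimes> c = a \<otimes> (b \<otimes> c)" "a \<otimes> b = b \<otimes> a" "b \<otimes> (a \<otimes> c) = a \<otimes> (b \<otimes> c)"
  using assms gamma2_commute[of a b] by (auto simp: m_assoc simp flip: m_assoc)

lemma pow_mult_gamma2:
  "a \<in> gamma2 G \<Longrightarrow> b \<in> gamma2 G \<Longrightarrow> (a \<otimes> b) [^] (n::nat) = a [^] n \<otimes> b [^] n"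
  by (intro pow_mult_distrib gamma2_commute) auto

lemma conjugate_gamma2_by_gamma2:
  "a \<in> gamma2 G \<Longrightarrow> b \<in> gamma2 G \<Longrightarrow> conjugate G a b = a"
  using gamma2_commute[of a b] by (simp add: conjugate_def m_assoc)

text \<open>The abelian group \<open>\<gamma>\<^sub>2\<close> acts trivially on itself, so the action of the whole group on it factors
through the abelianization.\<close>

lemma conjugate_gamma2_swap:
  assumes "a \<in> gamma2 G" "g \<in> carrier G" "h \<in> carrier G"
  shows "conjugate G (conjugate G a g) h = conjugate G (conjugate G a h) g"
proof -
  have "g \<otimes> h = (h \<otimes> g) \<otimes> commutator G g h"
    using assms by (simp add: commutator_def m_assoc)
  then have "conjugate G a (g \<otimes> h) = conjugate G a (h \<otimes> g)"
    using assms by (simp add: conjugate_by_mult[of a "h \<otimes> g"] conjugate_gamma2_by_gamma2 commutator_in_gamma2)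
  then show ?thesis
    using assms by (simp add: conjugate_by_mult)
qed

lemma commutator_gamma2_mult:
  assumes "a \<in> gamma2 G" "b \<in> gamma2 G" "g \<in> carrier G"
  shows "commutator G (a \<otimes> b) g = commutator G a g \<otimes> commutator G b g"
  using assms by (simp add: commutator_mult_left conjugate_gamma2_by_gamma2 commutator_in_gamma2)

lemma commutator_gamma2_inv:
  assumes "a \<in> gamma2 G" "g \<in> carrier G"
  shows "commutator G (inv a) g = inv (commutator G a g)"
  using assms by (simp add: commutator_inv_left conjugate_gamma2_by_gamma2 commutator_in_gamma2)

lemma commutator_gamma2_pow:
  assumes "a \<in> gamma2 G" "g \<in> carrier G"
  shows "commutator G (a [^] (n::nat)) g = commutator G a g [^] n"
proof (induction n)
  case 0
  then show ?case using assms by (simp add: commutator_def)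
qed (use assms in \<open>simp_all add: commutator_gamma2_mult\<close>)

lemma conjugate_commutator_gamma2:
  assumes "a \<in> gamma2 G" "x \<in> carrier G" "g \<in> carrier G"
  shows "conjugate G (commutator G a x) g = commutator G (conjugate G a g) x"
  using assms
  by (simp add: commutator_eq_inv_mult_conjugate conjugate_mult conjugate_inv conjugate_gamma2_swap)

text \<open>Write \<open>\<gamma>\<^sub>2\<close> additively. Then \<open>a \<mapsto> [a, z]\<close> is the endomorphism \<open>z - 1\<close>, which commutes with the action of
the group, so the kernel \<open>C\<close> of \<open>(z - 1)\<^sup>2\<close> is a normal subgroup. The relations put the commutators of the
generators into \<open>C\<close>, hence all of \<open>\<gamma>\<^sub>2\<close>.\<close>

lemma commutator_square_eq_one:
  assumes S: "S \<subseteq> carrier G" and gen: "generate G S = carrier G"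
    and rel: "\<And>x y z. x \<in> S \<Longrightarrow> y \<in> S \<Longrightarrow> z \<in> S \<Longrightarrow>
      commutator G (commutator G (commutator G x y) z) z = \<one>"
    and a: "a \<in> gamma2 G" and z: "z \<in> S"
  shows "commutator G (commutator G a z) z = \<one>"
proof -
  define C where "C = {a \<in> gamma2 G. commutator G (commutator G a z) z = \<one>}"
  have zG: "z \<in> carrier G" using S z by auto
  have "subgroup C G"
    unfolding C_def using zG
    by (intro subgroup.intro)
      (auto simp: commutator_gamma2_mult commutator_gamma2_inv commutator_in_gamma2 commutator_def[of G \<one>])
  then have "C \<lhd> G"
  proof (rule normal_invI)
    fix g c assume g: "g \<in> carrier G" and c: "c \<in> C"
    have "conjugate G c (inv g) \<in> C"
      using c g zG
      by (simp add: C_def commutator_in_gamma2 flip: conjugate_commutator_gamma2)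
    then show "g \<otimes> c \<otimes> inv g \<in> C" using g by (simp add: conjugate_def)
  qed
  moreover have "commutator G x y \<in> C" if "x \<in> S" "y \<in> S" for x y
    unfolding C_def using that S rel z by (auto intro: commutator_in_gamma2)
  ultimately have "gamma2 G \<subseteq> C"
    using S gen by (intro derived_subset_normal) auto
  with a show ?thesis by (auto simp: C_def)
qed

lemma commutator_pow_right:
  assumes "g \<in> carrier G" "h \<in> carrier G"
  shows "commutator G h (g [^] i) = prod_below G (\<lambda>j. conjugate G (commutator G h g) (g [^] j)) i"
proof (induction i)
  case 0
  then show ?case using assms by (simp add: commutator_def)
next
  case (Suc i)
  have "commutator G h (g [^] Suc i) =
    commutator G h (g [^] i) \<otimes> conjugate G (commutator G h g) (g [^] i)"
    using assms by (simp only: nat_pow_Suc2 commutator_mult_right nat_pow_closed)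
  also have "\<dots> = conjugate G (commutator G h g) (g [^] i) \<otimes> commutator G h (g [^] i)"
    using assms by (intro gamma2_commute) (simp_all add: commutator_in_gamma2)
  finally show ?case by (simp add: Suc)
qed

text \<open>With \<open>c = [h, g]\<close> and additive notation in \<open>\<gamma>\<^sub>2\<close>, the correction term is
\<open>\<Sum>\<^bsub>j < i < n\<^esub> h\<^sup>i g\<^sup>j c\<close>.\<close>

lemma power_mult_metabelian:
  assumes "g \<in> carrier G" "h \<in> carrier G"
  shows "(g \<otimes> h) [^] n = g [^] n \<otimes> h [^] n \<otimes>
    prod_below G (\<lambda>i. prod_below G
      (\<lambda>j. conjugate G (conjugate G (commutator G h g) (g [^] j)) (h [^] i)) i) n"
  using assms by (simp add: power_mult_collect commutator_pow_right conjugate_prod_below)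

end

section \<open>Polynomial families in the commutator subgroup\<close>

text \<open>Additively, these are the functions \<open>(i, j) \<mapsto> \<Sum>\<^bsub>a, b\<^esub> i\<^sup>a j\<^sup>b d\<^bsub>a b\<^esub>\<close> with finitely many coefficients
\<open>d\<^bsub>a b\<^esub>\<close> in \<open>\<gamma>\<^sub>2\<close>, that is, the polynomial functions in two variables.\<close>

inductive_set poly_families :: "('a, 'b) monoid_scheme \<Rightarrow> (nat \<Rightarrow> nat \<Rightarrow> 'a) set"
  for G :: "('a, 'b) monoid_scheme" where
  monomial: "d \<in> gamma2 G \<Longrightarrow> (\<lambda>i j. d [^]\<^bsub>G\<^esub> (i ^ a * j ^ b)) \<in> poly_families G"
| mult: "F \<in> poly_families G \<Longrightarrow> F' \<in> poly_families G \<Longrightarrow>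
    (\<lambda>i j. F i j \<otimes>\<^bsub>G\<^esub> F' i j) \<in> poly_families G"

text \<open>The elements whose powers act on \<open>\<gamma>\<^sub>2\<close> polynomially in the exponent. Asking for preservation of all
polynomial families, rather than for a polynomial formula for \<open>g\<^sup>i\<close>, makes closure under products immediate.\<close>

definition poly_actors :: "('a, 'b) monoid_scheme \<Rightarrow> 'a set" where
  "poly_actors G = {g \<in> carrier G. \<forall>F \<in> poly_families G.
     (\<lambda>i j. conjugate G (F i j) (g [^]\<^bsub>G\<^esub> i)) \<in> poly_families G \<and>
     (\<lambda>i j. conjugate G (F i j) (g [^]\<^bsub>G\<^esub> j)) \<in> poly_families G}"

context metabelian_group
begin

lemma poly_actor_closed: "g \<in> poly_actors G \<Longrightarrow> g \<in> carrier G"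
  by (simp add: poly_actors_def)

lemma poly_family_conjugate_pow:
  assumes "g \<in> poly_actors G" "F \<in> poly_families G"
  shows "(\<lambda>i j. conjugate G (F i j) (g [^] i)) \<in> poly_families G"
    and "(\<lambda>i j. conjugate G (F i j) (g [^] j)) \<in> poly_families G"
  using assms by (auto simp: poly_actors_def)

lemma poly_family_in_gamma2: "F \<in> poly_families G \<Longrightarrow> F i j \<in> gamma2 G"
  by (induction rule: poly_families.induct) simp_all

lemma poly_family_const: "d \<in> gamma2 G \<Longrightarrow> (\<lambda>i j. d) \<in> poly_families G"
  using poly_families.monomial[of d G 0 0] by simp

lemma poly_family_commutator:
  assumes "F \<in> poly_families G" "x \<in> carrier G"
  shows "(\<lambda>i j. commutator G (F i j) x) \<in> poly_families G"
  using assms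
proof (induction rule: poly_families.induct)
  case (monomial d a b)
  then show ?case
    using poly_families.monomial[OF commutator_in_gamma2[of d x]]
    by (simp add: commutator_gamma2_pow)
next
  case (mult F F')
  then show ?case
    by (simp add: commutator_gamma2_mult poly_family_in_gamma2 poly_families.mult)
qed

lemma poly_family_pow:
  assumes "F \<in> poly_families G"
  shows "(\<lambda>i j. F i j [^] (i ^ a * j ^ b)) \<in> poly_families G"
  using assms
proof (induction rule: poly_families.induct)
  case (monomial d a' b')
  then show ?case
    using poly_families.monomial[of d G "a' + a" "b' + b"]
    by (simp add: nat_pow_pow power_add mult_ac)
next
  case (mult F F')
  then show ?case
    by (simp add: pow_mult_gamma2 poly_family_in_gamma2 poly_families.mult)
qed

text \<open>The binomial formula \<open>(1 + X)\<^sup>n a = a + n X a\<close> for \<open>X = x - 1\<close> when \<open>X\<^sup>2 a = 0\<close>.\<close>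

lemma conjugate_pow_eq:
  assumes a: "a \<in> gamma2 G" and x: "x \<in> carrier G"
    and sq: "commutator G (commutator G a x) x = \<one>"
  shows "conjugate G a (x [^] (n::nat)) = a \<otimes> commutator G a x [^] n"
proof (induction n)
  case 0
  then show ?case using a by simp
next
  case (Suc n)
  have c: "commutator G a x \<in> gamma2 G" using a x by (simp add: commutator_in_gamma2)
  then have fix_c: "conjugate G (commutator G a x) x = commutator G a x"
    using sq x by (simp add: conjugate_eq_mult_commutator)
  have "conjugate G a (x [^] Suc n) = conjugate G (a \<otimes> commutator G a x [^] n) x"
    using a x by (simp add: conjugate_by_mult Suc)
  also have "\<dots> = a \<otimes> (commutator G a x \<otimes> commutator G a x [^] n)"
    using a x c by (simp add: conjugate_mult conjugate_pow fix_c conjugate_eq_mult_commutator[of a] m_assoc)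
  finally show ?case using c by (simp add: nat_pow_Suc2[symmetric] del: nat_pow_Suc)
qed

lemma poly_actor_of_square:
  assumes x: "x \<in> carrier G" and sq: "\<And>a. a \<in> gamma2 G \<Longrightarrow> commutator G (commutator G a x) x = \<one>"
  shows "x \<in> poly_actors G"
proof -
  have "(\<lambda>i j. conjugate G (F i j) (x [^] i)) \<in> poly_families G \<and>
        (\<lambda>i j. conjugate G (F i j) (x [^] j)) \<in> poly_families G"
    if F: "F \<in> poly_families G" for F
    using poly_families.mult[OF F poly_family_pow[OF poly_family_commutator[OF F x], of 1 0]]
      poly_families.mult[OF F poly_family_pow[OF poly_family_commutator[OF F x], of 0 1]]
    by (simp add: conjugate_pow_eq[OF poly_family_in_gamma2[OF F] x] sq poly_family_in_gamma2[OF F])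
  with x show ?thesis by (simp add: poly_actors_def)
qed

lemma poly_actor_one: "\<one> \<in> poly_actors G"
  by (intro poly_actor_of_square) (simp_all add: commutator_def)

text \<open>Since the actions of \<open>g\<close> and \<open>h\<close> on \<open>\<gamma>\<^sub>2\<close> commute, \<open>(g h)\<^sup>n\<close> acts like \<open>g\<^sup>n h\<^sup>n\<close>.\<close>

lemma conjugate_gamma2_mult_pow:
  assumes "a \<in> gamma2 G" "g \<in> carrier G" "h \<in> carrier G"
  shows "conjugate G a ((g \<otimes> h) [^] (n::nat)) = conjugate G (conjugate G a (g [^] n)) (h [^] n)"
proof (induction n)
  case (Suc n)
  have "conjugate G a ((g \<otimes> h) [^] Suc n) =
    conjugate G (conjugate G (conjugate G (conjugate G a (g [^] n)) (h [^] n)) g) h"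
    using assms by (simp add: conjugate_by_mult Suc)
  also have "\<dots> = conjugate G (conjugate G (conjugate G (conjugate G a (g [^] n)) g) (h [^] n)) h"
    using assms by (simp add: conjugate_gamma2_swap[of "conjugate G a (g [^] n)" "h [^] n" g])
  finally show ?case using assms by (simp add: conjugate_by_mult)
qed (use assms in simp)

lemma poly_actor_mult:
  assumes "g \<in> poly_actors G" "h \<in> poly_actors G"
  shows "g \<otimes> h \<in> poly_actors G"
  using assms unfolding poly_actors_def
  by (simp add: conjugate_gamma2_mult_pow poly_family_in_gamma2)

lemma prod_below_mult_gamma2:
  assumes "\<And>i. f i \<in> gamma2 G" "\<And>i. f' i \<in> gamma2 G"
  shows "prod_below G (\<lambda>i. f i \<otimes> f' i) n = prod_below G f n \<otimes> prod_below G f' n"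
  using assms by (induction n) (simp_all add: mult_ac_gamma2)

lemma prod_below_pow:
  assumes "d \<in> carrier G"
  shows "prod_below G (\<lambda>i. d [^] (w i :: nat)) n = d [^] (\<Sum>i<n. w i)"
  using assms by (induction n) (simp_all add: nat_pow_mult add.commute)

text \<open>Summing a monomial family over the triangle \<open>j < i < n\<close> multiplies its coefficient by a double power
sum. This is a multiple of \<open>m\<close>, and \<open>m\<close> kills \<open>\<gamma>\<^sub>2\<close>.\<close>

lemma prod_poly_family_eq_one:
  assumes F: "F \<in> poly_families G"
    and exponent: "\<And>a. a \<in> gamma2 G \<Longrightarrow> a [^] m = \<one>"
    and m: "\<And>a b. m dvd (\<Sum>i<n. \<Sum>j<i. i ^ a * j ^ b)"
  shows "prod_below G (\<lambda>i. prod_below G (F i) i) n = \<one>"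
  using F
proof (induction rule: poly_families.induct)
  case (monomial d a b)
  from m[of a b] obtain k where k: "(\<Sum>i<n. \<Sum>j<i. i ^ a * j ^ b) = m * k" by auto
  have "prod_below G (\<lambda>i. prod_below G (\<lambda>j. d [^] (i ^ a * j ^ b)) i) n = d [^] (m * k)"
    using monomial by (simp add: prod_below_pow k)
  also have "\<dots> = (d [^] m) [^] k"
    using monomial by (simp add: nat_pow_pow)
  also have "\<dots> = \<one>"
    using monomial exponent by simp
  finally show ?case .
next
  case (mult F F')
  then show ?case
    by (simp add: prod_below_mult_gamma2 poly_family_in_gamma2)
qed

text \<open>The correction term of \<open>power_mult_metabelian\<close> is the sum over the triangle of a polynomial family: it
arises from the constant family \<open>[h, g]\<close> by acting with \<open>g\<^sup>j\<close> and then with \<open>h\<^sup>i\<close>.\<close>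

lemma power_mult_poly_actors:
  fixes m n :: nat
  assumes "g \<in> poly_actors G" "h \<in> poly_actors G"
    and "\<And>a. a \<in> gamma2 G \<Longrightarrow> a [^] m = \<one>"
    and "\<And>a b. m dvd (\<Sum>i<n. \<Sum>j<i. i ^ a * j ^ b)"
  shows "(g \<otimes> h) [^] n = g [^] n \<otimes> h [^] n"
proof -
  have g: "g \<in> carrier G" and h: "h \<in> carrier G"
    using assms by (simp_all add: poly_actor_closed)
  have "(\<lambda>i j. commutator G h g) \<in> poly_families G"
    using g h by (intro poly_family_const commutator_in_gamma2)
  from poly_family_conjugate_pow(1)[OF assms(2) poly_family_conjugate_pow(2)[OF assms(1) this]]
  have "(\<lambda>i j. conjugate G (conjugate G (commutator G h g) (g [^] j)) (h [^] i)) \<in> poly_families G" .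
  then have "prod_below G (\<lambda>i. prod_below G
      (\<lambda>j. conjugate G (conjugate G (commutator G h g) (g [^] j)) (h [^] i)) i) n = \<one>"
    using assms(3,4) by (rule prod_poly_family_eq_one)
  then show ?thesis
    using g h by (simp add: power_mult_metabelian)
qed

text \<open>Taking \<open>p\<^sup>r\<close>-th powers is multiplicative on products of generators, and it kills each generator.\<close>

lemma power_foldr_mult_eq_one:
  fixes p r :: nat
  assumes p: "odd p"
    and S: "S \<subseteq> carrier G" and gen: "generate G S = carrier G"
    and rel: "\<And>x y z. x \<in> S \<Longrightarrow> y \<in> S \<Longrightarrow> z \<in> S \<Longrightarrow>
      commutator G (commutator G (commutator G x y) z) z = \<one>"
    and pow: "\<And>x. x \<in> S \<Longrightarrow> x [^] (p ^ r) = \<one>"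
    and exponent: "\<And>a. a \<in> gamma2 G \<Longrightarrow> a [^] (p ^ (r - 1)) = \<one>"
    and xs: "set xs \<subseteq> S"
  shows "foldr (\<otimes>) xs \<one> [^] (p ^ r) = \<one>"
proof -
  have S_actors: "x \<in> poly_actors G" if "x \<in> S" for x
    using that S commutator_square_eq_one[OF S gen rel] by (intro poly_actor_of_square) auto
  from xs have "foldr (\<otimes>) xs \<one> \<in> poly_actors G \<and> foldr (\<otimes>) xs \<one> [^] (p ^ r) = \<one>"
  proof (induction xs)
    case (Cons x xs)
    then have "(x \<otimes> foldr (\<otimes>) xs \<one>) [^] (p ^ r) = x [^] (p ^ r) \<otimes> foldr (\<otimes>) xs \<one> [^] (p ^ r)"
      using S_actors exponent double_power_sum_dvd[OF p, of r] by (intro power_mult_poly_actors) auto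
    with Cons pow S_actors show ?case by (simp add: poly_actor_mult)
  qed (simp add: poly_actor_one)
  then show ?thesis ..
qed

end

section \<open>Quotients and normal subgroups of powers\<close>

context group_hom
begin

lemma hom_commutator:
  "x \<in> carrier G \<Longrightarrow> y \<in> carrier G \<Longrightarrow> h (commutator G x y) = commutator H (h x) (h y)"
  by (simp add: commutator_def)

lemma hom_foldr_mult:
  assumes "set xs \<subseteq> carrier G"
  shows "foldr (\<otimes>\<^bsub>G\<^esub>) xs \<one>\<^bsub>G\<^esub> \<in> carrier G \<and>
    h (foldr (\<otimes>\<^bsub>G\<^esub>) xs \<one>\<^bsub>G\<^esub>) = foldr (\<otimes>\<^bsub>H\<^esub>) (map h xs) \<one>\<^bsub>H\<^esub>"
  using assms by (induction xs) auto

end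

lemma (in normal) group_hom_Mod: "group_hom G (G Mod H) (\<lambda>g. H #> g)"
  by (intro group_hom.intro group_hom_axioms.intro r_coset_hom_Mod factorgroup_is_group is_group)

lemma (in normal) coset_eq_one_iff:
  "x \<in> carrier G \<Longrightarrow> H #> x = \<one>\<^bsub>G Mod H\<^esub> \<longleftrightarrow> x \<in> H"
  using coset_join1[OF _ _ subgroup_axioms] coset_join2[OF _ subgroup_axioms] by auto

lemma (in normal) carrier_Mod: "carrier (G Mod H) = (\<lambda>g. H #> g) ` carrier G"
  by (auto simp: FactGroup_def RCOSETS_def)

context group
begin

lemma normal_power_subgroup:
  assumes "N \<lhd> G"
  shows "power_subgroup G N m \<lhd> G"
  unfolding power_subgroup_def
proof (rule normal_generateI)
  have N: "N \<subseteq> carrier G" using assms by (simp add: normal_imp_subgroup subgroup.subset)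
  then show "{a [^] m |a. a \<in> N} \<subseteq> carrier G" by auto
  fix x g assume "x \<in> {a [^] m |a. a \<in> N}" and g: "g \<in> carrier G"
  then obtain a where a: "a \<in> N" "x = a [^] m" by auto
  then have "g \<otimes> x \<otimes> inv g = conjugate G (a [^] m) (inv g)"
    using g by (simp add: conjugate_def)
  also have "\<dots> = conjugate G a (inv g) [^] m"
    using a g N by (intro conjugate_pow) auto
  finally have "g \<otimes> x \<otimes> inv g = conjugate G a (inv g) [^] m" .
  moreover have "conjugate G a (inv g) \<in> N"
    using a g assms by (simp add: conjugate_in_normal)
  ultimately show "g \<otimes> x \<otimes> inv g \<in> {a [^] m |a. a \<in> N}" by blast
qed

lemma normal_set_mult:
  assumes M: "M \<lhd> G" and N: "N \<lhd> G"
  shows "M <#> N \<lhd> G"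
proof (rule normal_invI)
  interpret second_isomorphism_grp M G N
    using M N by (intro second_isomorphism_grp.intro second_isomorphism_grp_axioms.intro normal_imp_subgroup)
  show "subgroup (M <#> N) G" by (rule normal_set_mult_subgroup)
  fix g x assume g: "g \<in> carrier G" and "x \<in> M <#> N"
  then obtain a b where ab: "a \<in> M" "b \<in> N" "x = a \<otimes> b" by (auto simp: set_mult_def)
  then have "a \<in> carrier G" "b \<in> carrier G"
    using M N normal_imp_subgroup subgroup.mem_carrier by metis+
  then have "g \<otimes> x \<otimes> inv g = conjugate G a (inv g) \<otimes> conjugate G b (inv g)"
    using ab g by (simp add: conjugate_def m_assoc)
  also have "\<dots> \<in> M <#> N"
    using ab g M N by (auto simp: set_mult_def intro: conjugate_in_normal)
  finally show "g \<otimes> x \<otimes> inv g \<in> M <#> N" .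
qed

text \<open>Modulo the normal subgroup on the right-hand side the group is metabelian and its \<open>\<gamma>\<^sub>2\<close> has exponent
dividing \<open>p\<^sup>r\<^sup>-\<^sup>1\<close>, so \<open>power_foldr_mult_eq_one\<close> applies to the quotient.\<close>

lemma power_foldr_mult_mem:
  fixes p r :: nat
  assumes p: "odd p"
    and S: "S \<subseteq> carrier G" and gen: "generate G S = carrier G"
    and rel: "\<And>x y z. x \<in> S \<Longrightarrow> y \<in> S \<Longrightarrow> z \<in> S \<Longrightarrow>
      commutator G (commutator G (commutator G x y) z) z = \<one>"
    and pow: "\<And>x. x \<in> S \<Longrightarrow> x [^] (p ^ r) = \<one>"
    and xs: "set xs \<subseteq> S"
  shows "foldr (\<otimes>) xs \<one> [^] (p ^ r)
    \<in> power_subgroup G (gamma2 G) (p ^ (r - 1)) <#> derived G (gamma2 G)"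
    (is "_ \<in> ?P <#> ?D")
proof -
  define N where "N = ?P <#> ?D"
  have A: "gamma2 G \<lhd> G" by (rule derived_self_is_normal)
  then have A_sub: "gamma2 G \<subseteq> carrier G" "subgroup (gamma2 G) G"
    by (simp_all add: normal_imp_subgroup subgroup.subset)
  have P: "?P \<lhd> G" and D: "?D \<lhd> G"
    using A by (auto intro: normal_power_subgroup derived_is_normal)
  interpret N: normal N G
    unfolding N_def by (rule normal_set_mult[OF P D])
  have PN: "x \<in> N" if "x \<in> ?P" for x
    using that subgroup.one_closed[OF normal_imp_subgroup[OF D]]
      subgroup.mem_carrier[OF normal_imp_subgroup[OF P] that]
    unfolding N_def set_mult_def by force
  have DN: "x \<in> N" if "x \<in> ?D" for x
    using that subgroup.one_closed[OF normal_imp_subgroup[OF P]]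
      subgroup.mem_carrier[OF normal_imp_subgroup[OF D] that]
    unfolding N_def set_mult_def by force
  let ?Q = "G Mod N"
  define h where "h = (\<lambda>g. N #> g)"
  interpret h: group_hom G ?Q h
    unfolding h_def by (rule N.group_hom_Mod)
  have h_one: "h x = \<one>\<^bsub>?Q\<^esub> \<longleftrightarrow> x \<in> N" if "x \<in> carrier G" for x
    unfolding h_def by (rule N.coset_eq_one_iff[OF that])
  have carrier_Q: "carrier ?Q = h ` carrier G"
    unfolding h_def by (rule N.carrier_Mod)
  have gamma2_Q: "gamma2 ?Q = h ` gamma2 G"
    unfolding carrier_Q by (rule h.derived_img) simp
  interpret Q: metabelian_group ?Q
  proof
    fix a b assume "a \<in> gamma2 ?Q" "b \<in> gamma2 ?Q"
    then obtain a' b' where ab: "a' \<in> gamma2 G" "a = h a'" "b' \<in> gamma2 G" "b = h b'"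
      by (auto simp: gamma2_Q)
    then have ab_in: "a' \<in> carrier G" "b' \<in> carrier G" using A_sub by auto
    have "commutator G a' b' \<in> ?D"
      unfolding derived_eq_generate_commutator[OF group_axioms A_sub(2)]
      using ab by (intro generate.incl) blast
    then have "h (commutator G a' b') = \<one>\<^bsub>?Q\<^esub>"
      using DN h_one ab_in by simp
    moreover have "a' \<otimes> b' = b' \<otimes> a' \<otimes> commutator G a' b'"
      using ab_in by (simp add: commutator_def m_assoc)
    then have "h a' \<otimes>\<^bsub>?Q\<^esub> h b' = h b' \<otimes>\<^bsub>?Q\<^esub> h a' \<otimes>\<^bsub>?Q\<^esub> h (commutator G a' b')"
      using ab_in by (metis commutator_closed h.hom_mult m_closed)
    ultimately show "a \<otimes>\<^bsub>?Q\<^esub> b = b \<otimes>\<^bsub>?Q\<^esub> a"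
      using ab ab_in by (metis h.H.r_one h.H.m_closed h.hom_closed)
  qed
  have xs_in: "set xs \<subseteq> carrier G" using xs S by auto
  have "foldr (\<otimes>\<^bsub>?Q\<^esub>) (map h xs) \<one>\<^bsub>?Q\<^esub> [^]\<^bsub>?Q\<^esub> (p ^ r) = \<one>\<^bsub>?Q\<^esub>"
  proof (rule Q.power_foldr_mult_eq_one[OF p, of "h ` S"])
    show "h ` S \<subseteq> carrier ?Q" using S by auto
    show "generate ?Q (h ` S) = carrier ?Q"
      using S by (simp only: h.generate_img gen carrier_Q)
    show "commutator ?Q (commutator ?Q (commutator ?Q x y) z) z = \<one>\<^bsub>?Q\<^esub>"
      if "x \<in> h ` S" "y \<in> h ` S" "z \<in> h ` S" for x y z
    proof -
      from that obtain x' y' z' where xyz: "x = h x'" "y = h y'" "z = h z'" "x' \<in> S" "y' \<in> S" "z' \<in> S"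
        by blast
      then have "x' \<in> carrier G" "y' \<in> carrier G" "z' \<in> carrier G" using S by auto
      then have "commutator ?Q (commutator ?Q (commutator ?Q x y) z) z =
        h (commutator G (commutator G (commutator G x' y') z') z')"
        by (simp only: xyz h.hom_commutator commutator_closed)
      then show ?thesis using rel xyz by simp
    qed
    show "x [^]\<^bsub>?Q\<^esub> (p ^ r) = \<one>\<^bsub>?Q\<^esub>" if "x \<in> h ` S" for x
      using that S pow by (metis h.hom_nat_pow h.hom_one imageE subsetD)
    show "a [^]\<^bsub>?Q\<^esub> (p ^ (r - 1)) = \<one>\<^bsub>?Q\<^esub>" if a: "a \<in> gamma2 ?Q" for a
    proof -
      from a obtain a' where a': "a' \<in> gamma2 G" "a = h a'" by (auto simp: gamma2_Q)
      then have "a' [^] (p ^ (r - 1)) \<in> ?P"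
        unfolding power_subgroup_def by (intro generate.incl) blast
      moreover have "a' \<in> carrier G" using a' A_sub by auto
      ultimately have "h (a' [^] (p ^ (r - 1))) = \<one>\<^bsub>?Q\<^esub>"
        using PN h_one by simp
      then show ?thesis using a' \<open>a' \<in> carrier G\<close> by (metis h.hom_nat_pow)
    qed
    show "set (map h xs) \<subseteq> h ` S" using xs by auto
  qed
  then have "h (foldr (\<otimes>) xs \<one> [^] (p ^ r)) = \<one>\<^bsub>?Q\<^esub>"
    using h.hom_foldr_mult[OF xs_in] by (metis h.hom_nat_pow)
  then show ?thesis
    using h.hom_foldr_mult[OF xs_in] h_one unfolding N_def by simp
qed

end

section \<open>The Cohen group\<close>

text \<open>The hypotheses of \<open>power_foldr_mult_mem\<close>, read off from the presentation: the commutator relation is the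
relator with index list \<open>[i, j, k, k]\<close>.\<close>

lemma cohen_group_presentation:
  fixes n q :: nat
  defines "K \<equiv> cohen_group n q" and "S \<equiv> cohen_gen n q ` {1..n}"
  shows "S \<subseteq> carrier K" and "generate K S = carrier K"
    and "\<And>x y z. x \<in> S \<Longrightarrow> y \<in> S \<Longrightarrow> z \<in> S \<Longrightarrow>
      commutator K (commutator K (commutator K x y) z) z = \<one>\<^bsub>K\<^esub>"
    and "\<And>x. x \<in> S \<Longrightarrow> x [^]\<^bsub>K\<^esub> q = \<one>\<^bsub>K\<^esub>"
proof -
  define F where "F = free_group {1..n}"
  define R where "R = normal_closure F (cohen_relators n q)"
  interpret F: group F unfolding F_def by (rule group_free_group)
  have relators: "cohen_relators n q \<subseteq> carrier F"
    unfolding F_def by (rule cohen_relators_in_carrier)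
  interpret R: normal R F
    unfolding R_def by (rule normal_normal_closure[OF F.group_axioms relators])
  define h where "h = (\<lambda>w. R #>\<^bsub>F\<^esub> w)"
  have K: "K = F Mod R" by (simp add: K_def cohen_group_def F_def R_def)
  interpret h: group_hom F K h
    unfolding h_def K by (rule R.group_hom_Mod)
  have gens: "free_gen i \<in> carrier F" if "i \<in> {1..n}" for i
    unfolding F_def by (rule free_gen_in_carrier[OF that])
  have carrier_K: "carrier K = h ` carrier F"
    unfolding h_def K by (rule R.carrier_Mod)
  have S: "S = h ` free_gen ` {1..n}"
    by (simp add: S_def h_def cohen_gen_def F_def R_def image_image)
  have relator: "h w = \<one>\<^bsub>K\<^esub>" if "w \<in> cohen_relators n q" for w
  proof -
    have w: "w \<in> carrier F" using that relators by blast
    have "\<one>\<^bsub>F\<^esub> \<otimes>\<^bsub>F\<^esub> w \<otimes>\<^bsub>F\<^esub> inv\<^bsub>F\<^esub> \<one>\<^bsub>F\<^esub> \<in> R"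
      unfolding R_def normal_closure_def using that by (intro generate.incl) blast
    then show ?thesis
      using w R.coset_eq_one_iff[OF w] by (simp add: K h_def)
  qed
  show "S \<subseteq> carrier K" unfolding S using gens by auto
  have "free_gen ` {1..n} \<subseteq> carrier F" using gens by blast
  then show "generate K S = carrier K"
    by (simp only: S h.generate_img carrier_K F_def generate_free_gen)
  show "commutator K (commutator K (commutator K x y) z) z = \<one>\<^bsub>K\<^esub>"
    if "x \<in> S" "y \<in> S" "z \<in> S" for x y z
  proof -
    from that obtain i j k where ijk: "i \<in> {1..n}" "j \<in> {1..n}" "k \<in> {1..n}"
      "x = h (free_gen i)" "y = h (free_gen j)" "z = h (free_gen k)"
      unfolding S by blast
    have "commutator K (commutator K (commutator K x y) z) z =
      h (left_normed_commutator F (map free_gen [i, j, k, k]))"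
      using ijk gens by (simp add: h.hom_commutator)
    also have "left_normed_commutator F (map free_gen [i, j, k, k]) \<in> cohen_relators n q"
      unfolding cohen_relators_def F_def using ijk(1-3)
      by (intro UnI1 CollectI exI[of _ "[i, j, k, k]"]) simp
    then have "h (left_normed_commutator F (map free_gen [i, j, k, k])) = \<one>\<^bsub>K\<^esub>"
      by (rule relator)
    finally show ?thesis .
  qed
  show "x [^]\<^bsub>K\<^esub> q = \<one>\<^bsub>K\<^esub>" if "x \<in> S" for x
  proof -
    from that obtain i where i: "i \<in> {1..n}" "x = h (free_gen i)" unfolding S by blast
    have "free_gen i [^]\<^bsub>F\<^esub> q \<in> cohen_relators n q"
      unfolding cohen_relators_def F_def using i(1) by blast
    from relator[OF this] show ?thesis
      using i gens by (simp add: h.hom_nat_pow)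
  qed
qed

theorem lemma2p6:
  fixes p n r :: nat
  assumes "Factorial_Ring.prime p" and "odd p" and "n \<ge> 1" and "r > 1"
  shows "let K = cohen_group n (p ^ r) in
         cohen_gen_prod n (p ^ r) [^]\<^bsub>K\<^esub> (p ^ r)
           \<in> power_subgroup K (gamma2 K) (p ^ (r - 1)) <#>\<^bsub>K\<^esub> derived K (gamma2 K)"
  unfolding Let_def cohen_gen_prod_def
proof (rule group.power_foldr_mult_mem[OF group_cohen_group \<open>odd p\<close> cohen_group_presentation])
  show "set (map (cohen_gen n (p ^ r)) [1..<Suc n]) \<subseteq> cohen_gen n (p ^ r) ` {1..n}"
    by auto
qed

end
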